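(* There is an algorithm that, given integers $p,q\ge1$, decides whether there exist antipalindromic numbers $A,B$ with $p/q=A/B$.
   Context: A positive integer $n$ is antipalindromic if its binary representation $w=w_1\cdots w_L$ (most significant digit first, no leading zeros) has even length $L$ and satisfies $w_i+w_{L+1-i}=1$ for all $i$. *)

theory Defs
  imports Complex_Main
begin

fun bin_digits :: "nat \<Rightarrow> bool list" where
  "bin_digits n = (if n = 0 then [] else bin_digits (n div 2) @ [odd n])"

definition antipalindromic :: "nat \<Rightarrow> bool" where
  "antipalindromic n \<longleftrightarrow>
     (let w = bin_digits n; L = length w in
        n > 0 \<and> even L \<and>
        (\<forall>i\<in>{1..L}. of_bool (w ! (i - 1)) + of_bool (w ! (L - i)) = (1::nat)))"

type_synonym state = "nat \<Rightarrow> nat"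

datatype aexp = N nat | V nat | Plus aexp aexp | Minus aexp aexp | Times aexp aexp

fun aval :: "aexp \<Rightarrow> state \<Rightarrow> nat" where
  "aval (N k) s = k"
| "aval (V x) s = s x"
| "aval (Plus a b) s = aval a s + aval b s"
| "aval (Minus a b) s = aval a s - aval b s"
| "aval (Times a b) s = aval a s * aval b s"

datatype bexp = Bc bool | Not bexp | And bexp bexp | Less aexp aexp

fun bval :: "bexp \<Rightarrow> state \<Rightarrow> bool" where
  "bval (Bc v) s = v"
| "bval (Not b) s = (\<not> bval b s)"
| "bval (And b1 b2) s = (bval b1 s \<and> bval b2 s)"
| "bval (Less a1 a2) s = (aval a1 s < aval a2 s)"

datatype com = SKIP | Assign nat aexp | Seq com com | If bexp com com | While bexp com

inductive big_step :: "com \<Rightarrow> state \<Rightarrow> state \<Rightarrow> bool" where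
  Skip: "big_step SKIP s s"
| Assign: "big_step (Assign x a) s (s(x := aval a s))"
| Seq: "big_step c1 s1 s2 \<Longrightarrow> big_step c2 s2 s3 \<Longrightarrow> big_step (Seq c1 c2) s1 s3"
| IfTrue: "bval b s \<Longrightarrow> big_step c1 s t \<Longrightarrow> big_step (If b c1 c2) s t"
| IfFalse: "\<not> bval b s \<Longrightarrow> big_step c2 s t \<Longrightarrow> big_step (If b c1 c2) s t"
| WhileFalse: "\<not> bval b s \<Longrightarrow> big_step (While b c) s s"
| WhileTrue: "bval b s1 \<Longrightarrow> big_step c s1 s2 \<Longrightarrow> big_step (While b c) s2 s3
              \<Longrightarrow> big_step (While b c) s1 s3"

definition init2 :: "nat \<Rightarrow> nat \<Rightarrow> state" where
  "init2 p q = (\<lambda>i. if i = 0 then p else if i = 1 then q else 0)"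

end

theory Submission
  imports Defs
begin

text \<open>An antipalindromic number of binary length 2m is the value of a word u ubar, where
  u has length m and leading digit 1 and ubar is the reversed complement of u. Given
  q A = p B with A = u ubar and B = v vbar (v not longer than u), cut u and v after their
  k-th digits: the defect q A - p B splits into a contribution of the two prefixes and a
  contribution of the two suffixes, and the pair of integers recording this split is
  confined to a box of size (4p + q + 1)(p + q + 1). If v is longer than that, two cuts
  produce the same pair and the digits between them can be deleted from both words without
  changing the defect. So a solution exists iff one exists below an explicit bound, and a
  WHILE program can search all candidates below it, testing antipalindromicity by peeling
  off outer digit pairs.\<close>

section \<open>Binary words and antipalindromes\<close>

declare bin_digits.simps [simp del]

fun nat_of_bits :: "bool list \<Rightarrow> nat" where
  "nat_of_bits [] = 0"
| "nat_of_bits (b # bs) = of_bool b * 2 ^ length bs + nat_of_bits bs"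

definition anti_rev :: "bool list \<Rightarrow> bool list" where
  "anti_rev u = map (\<lambda>b. \<not> b) (rev u)"

lemma nat_of_bits_append:
  "nat_of_bits (xs @ ys) = nat_of_bits xs * 2 ^ length ys + nat_of_bits ys"
  by (induction xs) (auto simp: algebra_simps power_add)

lemma nat_of_bits_snoc: "nat_of_bits (xs @ [b]) = 2 * nat_of_bits xs + of_bool b"
  by (simp add: nat_of_bits_append)

lemma nat_of_bits_less: "nat_of_bits bs < 2 ^ length bs"
proof (induction bs)
  case (Cons b bs)
  then show ?case by (cases b) auto
qed simp

lemma nat_of_bits_ge_if_hd: "bs \<noteq> [] \<Longrightarrow> hd bs \<Longrightarrow> 2 ^ (length bs - 1) \<le> nat_of_bits bs"
  by (cases bs) auto

lemma nat_of_bits_less_if_not_hd: "bs \<noteq> [] \<Longrightarrow> \<not> hd bs \<Longrightarrow> nat_of_bits bs < 2 ^ (length bs - 1)"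
  by (cases bs) (auto simp: nat_of_bits_less)

lemma nat_of_bits_pos: "bs \<noteq> [] \<Longrightarrow> hd bs \<Longrightarrow> 0 < nat_of_bits bs"
  using nat_of_bits_ge_if_hd[of bs] by (meson less_le_trans zero_less_numeral zero_less_power)

lemma bin_digits_0 [simp]: "bin_digits 0 = []"
  by (simp add: bin_digits.simps)

lemma bin_digits_pos: "0 < n \<Longrightarrow> bin_digits n = bin_digits (n div 2) @ [odd n]"
  by (simp add: bin_digits.simps)

lemma nat_of_bits_bin_digits [simp]: "nat_of_bits (bin_digits n) = n"
proof (induction n rule: less_induct)
  case (less n)
  show ?case
  proof (cases "n = 0")
    case False
    then show ?thesis
      using less.IH[of "n div 2"] by (simp add: bin_digits_pos nat_of_bits_snoc)
  qed simp
qed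

lemma bin_digits_hd: "0 < n \<Longrightarrow> bin_digits n \<noteq> [] \<and> hd (bin_digits n)"
proof (induction n rule: less_induct)
  case (less n)
  show ?case
  proof (cases "n div 2 = 0")
    case True
    with less.prems have "n = 1" by auto
    then show ?thesis by (simp add: bin_digits_pos)
  next
    case False
    then show ?thesis
      using less.IH[of "n div 2"] less.prems by (simp add: bin_digits_pos[of n])
  qed
qed

lemma bin_digits_nat_of_bits: "bs \<noteq> [] \<Longrightarrow> hd bs \<Longrightarrow> bin_digits (nat_of_bits bs) = bs"
proof (induction bs rule: rev_induct)
  case (snoc b bs)
  show ?case
  proof (cases "bs = []")
    case True
    with snoc.prems show ?thesis by (simp add: bin_digits_pos)
  next
    case False
    with snoc have "hd bs" "bin_digits (nat_of_bits bs) = bs" by auto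
    with False show ?thesis
      using nat_of_bits_pos[of bs] by (simp add: nat_of_bits_snoc bin_digits_pos)
  qed
qed simp

lemma anti_rev_Nil [simp]: "anti_rev [] = []"
  by (simp add: anti_rev_def)

lemma length_anti_rev [simp]: "length (anti_rev u) = length u"
  by (simp add: anti_rev_def)

lemma anti_rev_append: "anti_rev (xs @ ys) = anti_rev ys @ anti_rev xs"
  by (simp add: anti_rev_def)

lemma anti_rev_anti_rev [simp]: "anti_rev (anti_rev u) = u"
  by (simp add: anti_rev_def rev_map comp_def)

lemma anti_rev_eq_iff_nth:
  "anti_rev w = w \<longleftrightarrow>
     (\<forall>i\<in>{1..length w}. of_bool (w ! (i - 1)) + of_bool (w ! (length w - i)) = (1::nat))"
proof -
  have "anti_rev w = w \<longleftrightarrow> (\<forall>j<length w. w ! j = (\<not> w ! (length w - Suc j)))"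
    by (auto simp: anti_rev_def list_eq_iff_nth_eq rev_nth)
  also have "\<dots> \<longleftrightarrow> (\<forall>i\<in>{1..length w}. w ! (i - 1) = (\<not> w ! (length w - i)))"
    unfolding image_Suc_lessThan[symmetric] by (simp add: lessThan_def)
  finally show ?thesis
    by (simp add: of_bool_def) blast
qed

lemma anti_rev_eq_iff: "anti_rev w = w \<longleftrightarrow> (\<exists>u. w = u @ anti_rev u)"
proof
  assume fixed: "anti_rev w = w"
  define m where "m = length w div 2"
  have "even (length w)" \<comment> \<open>otherwise the middle digit would equal its own negation\<close>
  proof (rule ccontr)
    assume "odd (length w)"
    then have "m < length w" "length w - Suc m = m" unfolding m_def by presburger+
    then have "w ! m = (\<not> w ! m)"
      using arg_cong[OF fixed, of "\<lambda>w. w ! m"] by (simp add: anti_rev_def rev_nth)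
    then show False by simp
  qed
  then have "length w - m = m"
    unfolding m_def by auto
  then have "drop m w = anti_rev (take m w)"
    using arg_cong[OF fixed, of "drop m"] by (simp add: anti_rev_def drop_map drop_rev)
  then show "\<exists>u. w = u @ anti_rev u"
    by (metis append_take_drop_id)
next
  assume "\<exists>u. w = u @ anti_rev u"
  then show "anti_rev w = w" by (auto simp: anti_rev_append)
qed

lemma antipalindromic_iff:
  "antipalindromic n \<longleftrightarrow> (\<exists>u. u \<noteq> [] \<and> hd u \<and> n = nat_of_bits (u @ anti_rev u))"
proof -
  define w where "w = bin_digits n"
  have "antipalindromic n \<longleftrightarrow> 0 < n \<and> even (length w) \<and> anti_rev w = w"
    unfolding antipalindromic_def Let_def anti_rev_eq_iff_nth w_def by blast
  also have "\<dots> \<longleftrightarrow> 0 < n \<and> (\<exists>u. w = u @ anti_rev u)"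
    using anti_rev_eq_iff[of w] by auto
  also have "\<dots> \<longleftrightarrow> (\<exists>u. u \<noteq> [] \<and> hd u \<and> n = nat_of_bits (u @ anti_rev u))"
  proof (intro iffI; elim conjE exE)
    fix u assume "0 < n" and w: "w = u @ anti_rev u"
    from \<open>0 < n\<close> have "w \<noteq> []" "hd w"
      unfolding w_def by (simp_all add: bin_digits_hd)
    with w have "u \<noteq> []" "hd u"
      by auto
    moreover have "n = nat_of_bits (u @ anti_rev u)"
      using nat_of_bits_bin_digits[of n] by (simp add: w[symmetric] w_def)
    ultimately show "\<exists>u. u \<noteq> [] \<and> hd u \<and> n = nat_of_bits (u @ anti_rev u)"
      by blast
  next
    fix u assume u: "u \<noteq> []" "hd u" and n: "n = nat_of_bits (u @ anti_rev u)"
    have "bin_digits (nat_of_bits (u @ anti_rev u)) = u @ anti_rev u"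
      using u by (intro bin_digits_nat_of_bits) auto
    then have "w = u @ anti_rev u"
      by (simp add: w_def n)
    moreover have "0 < n"
      unfolding n using u by (intro nat_of_bits_pos) auto
    ultimately show "0 < n \<and> (\<exists>u. w = u @ anti_rev u)"
      by blast
  qed
  finally show ?thesis .
qed

lemma antipalindromic_pos: "antipalindromic n \<Longrightarrow> 0 < n"
  unfolding antipalindromic_def Let_def by blast

lemma nat_of_bits_antisym_less: "nat_of_bits (u @ anti_rev u) < 4 ^ length u"
  using nat_of_bits_less[of "u @ anti_rev u"] by (simp add: mult_2[symmetric] power_mult)

lemma nat_of_bits_antisym_ge:
  "u \<noteq> [] \<Longrightarrow> hd u \<Longrightarrow> 2 ^ (2 * length u - 1) \<le> nat_of_bits (u @ anti_rev u)"
  using nat_of_bits_ge_if_hd[of "u @ anti_rev u"] by (simp add: mult_2)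

definition antisym_vals :: "nat \<Rightarrow> nat set" where
  "antisym_vals k = {nat_of_bits (u @ anti_rev u) | u. length u = k}"

lemma nat_of_bits_antisym_Cons:
  "nat_of_bits ((b # u) @ anti_rev (b # u))
     = of_bool b * 2 ^ (2 * length u + 1) + 2 * nat_of_bits (u @ anti_rev u) + of_bool (\<not> b)"
proof -
  have "(b # u) @ anti_rev (b # u) = b # (u @ anti_rev u) @ [\<not> b]"
    by (simp add: anti_rev_def)
  then show ?thesis
    by (simp only: nat_of_bits.simps nat_of_bits_snoc) (simp add: mult_2)
qed

lemma antisym_vals_0: "antisym_vals 0 = {0}"
  by (simp add: antisym_vals_def anti_rev_def)

lemma antisym_vals_Suc:
  "antisym_vals (Suc k)
     = {of_bool b * 2 ^ (2 * k + 1) + 2 * g + of_bool (\<not> b) | b g. g \<in> antisym_vals k}"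
proof safe
  fix A assume "A \<in> antisym_vals (Suc k)"
  then obtain b u where u: "length u = k" and A: "A = nat_of_bits ((b # u) @ anti_rev (b # u))"
    unfolding antisym_vals_def by (auto simp: length_Suc_conv)
  have "A = of_bool b * 2 ^ (2 * k + 1) + 2 * nat_of_bits (u @ anti_rev u) + of_bool (\<not> b)"
    unfolding A nat_of_bits_antisym_Cons u ..
  moreover have "nat_of_bits (u @ anti_rev u) \<in> antisym_vals k"
    using u unfolding antisym_vals_def by blast
  ultimately show "\<exists>b g. A = of_bool b * 2 ^ (2 * k + 1) + 2 * g + of_bool (\<not> b) \<and> g \<in> antisym_vals k"
    by blast
next
  fix b g assume "g \<in> antisym_vals k"
  then obtain u where u: "length u = k" and g: "g = nat_of_bits (u @ anti_rev u)"
    unfolding antisym_vals_def by blast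
  have "of_bool b * 2 ^ (2 * k + 1) + 2 * g + of_bool (\<not> b)
      = nat_of_bits ((b # u) @ anti_rev (b # u))"
    unfolding nat_of_bits_antisym_Cons u g ..
  moreover have "length (b # u) = Suc k"
    using u by simp
  ultimately show "of_bool b * 2 ^ (2 * k + 1) + 2 * g + of_bool (\<not> b) \<in> antisym_vals (Suc k)"
    unfolding antisym_vals_def by blast
qed

lemma antisym_vals_less:
  assumes "g \<in> antisym_vals k"
  shows "g < 2 ^ (2 * k)"
proof -
  from assms obtain u where "length u = k" "g = nat_of_bits (u @ anti_rev u)"
    unfolding antisym_vals_def by blast
  then show ?thesis
    using nat_of_bits_less[of "u @ anti_rev u"] by (simp add: mult_2)
qed

text \<open>The outer digits of u ubar differ: either the leading digit, of weight 2^(2k+1), is 1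
  and the number is even, or it is 0 and the number is odd.\<close>
fun peel_test :: "nat \<Rightarrow> nat \<Rightarrow> bool" where
  "peel_test 0 A \<longleftrightarrow> A = 0"
| "peel_test (Suc k) A \<longleftrightarrow>
     (if 2 ^ (2 * k + 1) \<le> A
      then even (A - 2 ^ (2 * k + 1)) \<and> peel_test k ((A - 2 ^ (2 * k + 1)) div 2)
      else odd A \<and> peel_test k (A div 2))"

lemma peel_test_iff: "peel_test k A \<longleftrightarrow> A \<in> antisym_vals k"
proof (induction k arbitrary: A)
  case 0
  then show ?case by (simp add: antisym_vals_0)
next
  case (Suc k)
  define P :: nat where "P = 2 ^ (2 * k + 1)"
  have "A \<in> antisym_vals (Suc k) \<longleftrightarrow>
      (P \<le> A \<and> even (A - P) \<and> (A - P) div 2 \<in> antisym_vals k) \<or>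
      (\<not> P \<le> A \<and> odd A \<and> A div 2 \<in> antisym_vals k)"
  proof
    assume "A \<in> antisym_vals (Suc k)"
    then obtain b g where g: "g \<in> antisym_vals k" and A: "A = of_bool b * P + 2 * g + of_bool (\<not> b)"
      unfolding antisym_vals_Suc P_def by blast
    have "2 * g + 1 < P"
      using antisym_vals_less[OF g] unfolding P_def by simp
    with A g show "(P \<le> A \<and> even (A - P) \<and> (A - P) div 2 \<in> antisym_vals k) \<or>
      (\<not> P \<le> A \<and> odd A \<and> A div 2 \<in> antisym_vals k)"
      by (cases b) simp_all
  next
    assume "(P \<le> A \<and> even (A - P) \<and> (A - P) div 2 \<in> antisym_vals k) \<or>
      (\<not> P \<le> A \<and> odd A \<and> A div 2 \<in> antisym_vals k)"
    then have "\<exists>b. \<exists>g\<in>antisym_vals k. A = of_bool b * P + 2 * g + of_bool (\<not> b)"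
    proof (elim disjE conjE)
      assume "P \<le> A" "even (A - P)" "(A - P) div 2 \<in> antisym_vals k"
      then show ?thesis by (intro exI[of _ True] bexI[of _ "(A - P) div 2"]) auto
    next
      assume "odd A" "A div 2 \<in> antisym_vals k"
      then show ?thesis by (intro exI[of _ False] bexI[of _ "A div 2"]) auto
    qed
    then show "A \<in> antisym_vals (Suc k)"
      unfolding antisym_vals_Suc P_def by blast
  qed
  then show ?case
    using Suc.IH by (simp add: P_def)
qed

lemma antipalindromic_iff_peel_test:
  "antipalindromic A \<longleftrightarrow> (\<exists>m. 1 \<le> m \<and> m \<le> A \<and> 2 ^ (2 * m - 1) \<le> A \<and> peel_test m A)"
proof
  assume "antipalindromic A"
  then obtain u where u: "u \<noteq> []" "hd u" "A = nat_of_bits (u @ anti_rev u)"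
    unfolding antipalindromic_iff by blast
  define m where "m = length u"
  have "1 \<le> m"
    using u m_def by (cases u) auto
  have lower: "2 ^ (2 * m - 1) \<le> A"
    using nat_of_bits_antisym_ge u m_def by simp
  have "m < 2 ^ m" by (rule less_exp)
  also have "\<dots> \<le> 2 ^ (2 * m - 1)" by (rule power_increasing) (use \<open>1 \<le> m\<close> in auto)
  finally have "m \<le> A" using lower by simp
  moreover have "peel_test m A"
    unfolding peel_test_iff antisym_vals_def using u m_def by blast
  ultimately show "\<exists>m. 1 \<le> m \<and> m \<le> A \<and> 2 ^ (2 * m - 1) \<le> A \<and> peel_test m A"
    using \<open>1 \<le> m\<close> lower by blast
next
  assume "\<exists>m. 1 \<le> m \<and> m \<le> A \<and> 2 ^ (2 * m - 1) \<le> A \<and> peel_test m A"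
  then obtain m u where mu: "1 \<le> m" "2 ^ (2 * m - 1) \<le> A" "length u = m"
      "A = nat_of_bits (u @ anti_rev u)"
    unfolding peel_test_iff antisym_vals_def by blast
  then have "u \<noteq> []" by auto
  moreover have "hd u"
  proof (rule ccontr)
    assume "\<not> hd u"
    with \<open>u \<noteq> []\<close> have "nat_of_bits (u @ anti_rev u) < 2 ^ (length (u @ anti_rev u) - 1)"
      by (intro nat_of_bits_less_if_not_hd) auto
    with mu show False by (simp add: mult_2)
  qed
  ultimately show "antipalindromic A"
    unfolding antipalindromic_iff using mu by blast
qed

section \<open>Bounding the smallest solution\<close>

lemma nat_of_bits_antisym_append:
  "nat_of_bits ((x @ z) @ anti_rev (x @ z))
     = nat_of_bits x * 4 ^ length z * 2 ^ length x + nat_of_bits (z @ anti_rev z) * 2 ^ length x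
       + nat_of_bits (anti_rev x)"
proof -
  have "(x @ z) @ anti_rev (x @ z) = x @ (z @ anti_rev z) @ anti_rev x"
    by (simp add: anti_rev_append)
  moreover have "(4::nat) ^ length z = 2 ^ length z * 2 ^ length z"
    by (simp flip: power_mult_distrib)
  ultimately show ?thesis
    by (simp add: nat_of_bits_append power_add algebra_simps)
qed

definition defect :: "nat \<Rightarrow> nat \<Rightarrow> bool list \<Rightarrow> bool list \<Rightarrow> int" where
  "defect p q u v =
     int q * int (nat_of_bits (u @ anti_rev u)) - int p * int (nat_of_bits (v @ anti_rev v))"

definition head_defect :: "nat \<Rightarrow> nat \<Rightarrow> nat \<Rightarrow> bool list \<Rightarrow> bool list \<Rightarrow> int" where
  "head_defect p q d x y = int q * int (nat_of_bits x) * 4 ^ d - int p * int (nat_of_bits y)"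

definition tail_defect :: "nat \<Rightarrow> nat \<Rightarrow> bool list \<Rightarrow> bool list \<Rightarrow> int" where
  "tail_defect p q x y = int q * int (nat_of_bits (anti_rev x)) - int p * int (nat_of_bits (anti_rev y))"

lemma defect_eq_0_iff:
  "defect p q u v = 0 \<longleftrightarrow> q * nat_of_bits (u @ anti_rev u) = p * nat_of_bits (v @ anti_rev v)"
  unfolding defect_def by (simp flip: of_nat_mult)

lemma defect_append:
  assumes "length x = length y" "length z = length w + d"
  shows "defect p q (x @ z) (y @ w)
    = 2 ^ length x * (head_defect p q d x y * 4 ^ length w + defect p q z w) + tail_defect p q x y"
  unfolding defect_def head_defect_def tail_defect_def nat_of_bits_antisym_append
  by (simp add: assms power_add algebra_simps)

text \<open>The state of a carry automaton after reading the outer k digits at both ends of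
  u ubar and v vbar, where d is the length difference of u and v.\<close>
definition cut_state :: "nat \<Rightarrow> nat \<Rightarrow> nat \<Rightarrow> bool list \<Rightarrow> bool list \<Rightarrow> nat \<Rightarrow> int \<times> int" where
  "cut_state p q d u v k =
     (head_defect p q d (take k u) (take k v),
      head_defect p q d (take k u) (take k v) * 4 ^ (length v - k) + defect p q (drop k u) (drop k v))"

lemma defect_cut:
  assumes "length v \<le> length u" "d = length u - length v" "k \<le> length v"
  shows "defect p q u v = 2 ^ k * snd (cut_state p q d u v k) + tail_defect p q (take k u) (take k v)"
  using defect_append[of "take k u" "take k v" "drop k u" "drop k v" d p q] assms
  by (simp add: cut_state_def)

lemma defect_pump:
  assumes "length v \<le> length u" "d = length u - length v" "k1 \<le> k2" "k2 \<le> length v"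
    and "cut_state p q d u v k1 = cut_state p q d u v k2"
  shows "defect p q (take k1 u @ drop k2 u) (take k1 v @ drop k2 v) = defect p q u v"
proof -
  define H where "H = head_defect p q d (take k1 u) (take k1 v)"
  define E where "E = snd (cut_state p q d u v k1)"
  have "head_defect p q d (take k2 u) (take k2 v) = H"
    using arg_cong[OF assms(5), of fst] unfolding H_def cut_state_def by simp
  then have E2: "H * 4 ^ (length v - k2) + defect p q (drop k2 u) (drop k2 v) = E"
    using arg_cong[OF assms(5), of snd] unfolding E_def cut_state_def by simp
  have "defect p q (take k1 u @ drop k2 u) (take k1 v @ drop k2 v)
      = 2 ^ k1 * (H * 4 ^ (length v - k2) + defect p q (drop k2 u) (drop k2 v))
        + tail_defect p q (take k1 u) (take k1 v)"
    unfolding H_def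
    using defect_append[of "take k1 u" "take k1 v" "drop k2 u" "drop k2 v" d p q] assms(1-4)
    by simp
  also have "\<dots> = 2 ^ k1 * E + tail_defect p q (take k1 u) (take k1 v)"
    unfolding E2 ..
  also have "\<dots> = defect p q u v"
    unfolding E_def using defect_cut[of v u d k1 p q] assms(1-4) by simp
  finally show ?thesis .
qed

lemma scaled_diff_bounds:
  fixes a b A B p q :: nat
  assumes "a < A" "b < B" "1 \<le> p" "1 \<le> q"
  shows "- (int p * int B) < int q * int a - int p * int b"
    and "int q * int a - int p * int b < int q * int A"
proof -
  have "int p * int b < int p * int B" "int q * int a < int q * int A"
    using assms by simp_all
  moreover have "0 \<le> int q * int a"
    by simp
  ultimately show "- (int p * int B) < int q * int a - int p * int b"
    by linarith
  have "0 \<le> int p * int b"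
    by simp
  with \<open>int q * int a < int q * int A\<close> show "int q * int a - int p * int b < int q * int A"
    by linarith
qed

lemma length_gap_bound:
  assumes "u \<noteq> []" "hd u" "length v \<le> length u" "1 \<le> p" "defect p q u v = 0"
  shows "int q * 4 ^ (length u - length v) < 2 * int p"
proof -
  define m n where "m = length u" and "n = length v"
  have "1 \<le> m" using assms m_def by (cases u) auto
  have "(4::nat) ^ (m - n) * 4 ^ n = 4 ^ m"
    using assms(3) m_def n_def by (simp flip: power_add)
  also have "\<dots> = 2 ^ Suc (2 * m - 1)"
    using \<open>1 \<le> m\<close> by (simp add: power_mult)
  finally have "q * 4 ^ (m - n) * 4 ^ n = 2 * (q * 2 ^ (2 * m - 1))"
    by (simp add: mult.assoc mult.left_commute)
  also have "q * 2 ^ (2 * m - 1) \<le> q * nat_of_bits (u @ anti_rev u)"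
    using nat_of_bits_antisym_ge[OF assms(1,2)] m_def by simp
  also have "\<dots> = p * nat_of_bits (v @ anti_rev v)"
    using assms(5) unfolding defect_eq_0_iff .
  also have "2 * \<dots> < 2 * p * 4 ^ n"
    using nat_of_bits_antisym_less[of v] assms(4) n_def by simp
  finally have "q * 4 ^ (m - n) < 2 * p"
    by simp
  then have "int (q * 4 ^ (m - n)) < int (2 * p)"
    by (simp only: of_nat_less_iff)
  then show ?thesis
    by (simp add: m_def n_def)
qed

definition cut_box :: "nat \<Rightarrow> nat \<Rightarrow> (int \<times> int) set" where
  "cut_box p q = {- (2 * int p + int q)..2 * int p} \<times> {- int q..int p}"

lemma card_cut_box: "card (cut_box p q) = (4 * p + q + 1) * (p + q + 1)"
proof -
  have "2 * int p - - (2 * int p + int q) + 1 = int (4 * p + q + 1)"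
    and "int p - - int q + 1 = int (p + q + 1)"
    by simp_all
  then show ?thesis
    unfolding cut_box_def card_cartesian_product card_atLeastAtMost_int by (simp only: nat_int)
qed

lemma cut_state_snd_bounds:
  assumes "1 \<le> p" "1 \<le> q" "length v \<le> length u" "d = length u - length v" "k \<le> length v"
    and "defect p q u v = 0"
  shows "- int q < snd (cut_state p q d u v k)" "snd (cut_state p q d u v k) < int p"
proof -
  define E where "E = snd (cut_state p q d u v k)"
  have "2 ^ k * E = - tail_defect p q (take k u) (take k v)"
    using defect_cut[OF assms(3-5), of p q] assms(6) unfolding E_def by simp
  moreover have "nat_of_bits (anti_rev (take k u)) < 2 ^ k" "nat_of_bits (anti_rev (take k v)) < 2 ^ k"
    using nat_of_bits_less[of "anti_rev (take k u)"] nat_of_bits_less[of "anti_rev (take k v)"] assms(3,5)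
    by simp_all
  note scaled_diff_bounds[OF this assms(1,2)]
  then have "- (int p * 2 ^ k) < tail_defect p q (take k u) (take k v)"
    "tail_defect p q (take k u) (take k v) < int q * 2 ^ k"
    unfolding tail_defect_def by simp_all
  ultimately have "2 ^ k * (- int q) < 2 ^ k * E" "2 ^ k * E < 2 ^ k * int p"
    by (simp_all add: algebra_simps)
  then show "- int q < E" "E < int p"
    using mult_less_cancel_left_pos[of "2 ^ k :: int" "- int q" E]
      mult_less_cancel_left_pos[of "2 ^ k :: int" E "int p"] by simp_all
qed

lemma cut_state_in_box:
  assumes "1 \<le> p" "1 \<le> q" "length v \<le> length u" "d = length u - length v" "k \<le> length v"
    and "defect p q u v = 0" and gap: "int q * 4 ^ d < 2 * int p"
  shows "cut_state p q d u v k \<in> cut_box p q"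
proof -
  obtain H E where HE: "cut_state p q d u v k = (H, E)"
    by (cases "cut_state p q d u v k")
  with cut_state_snd_bounds[OF assms(1-6)] have E: "- int q < E" "E < int p"
    by simp_all
  define T :: int where "T = 4 ^ (length v - k)"
  define D where "D = defect p q (drop k u) (drop k v)"
  have "T > 0"
    unfolding T_def by simp
  have HT: "H * T = E - D"
    using HE unfolding cut_state_def T_def D_def by auto
  have "nat_of_bits (drop k u @ anti_rev (drop k u)) < 4 ^ d * 4 ^ (length v - k)"
    using nat_of_bits_antisym_less[of "drop k u"] assms(3-5) by (simp flip: power_add)
  note scaled_diff_bounds[OF this nat_of_bits_antisym_less[of "drop k v"] assms(1,2)]
  then have D: "- (int p * T) < D" "D < int q * (4 ^ d * T)"
    unfolding D_def defect_def T_def by simp_all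
  have "int q * (4 ^ d * T) < 2 * int p * T"
    using gap \<open>T > 0\<close> by (simp add: mult.assoc[symmetric])
  moreover have "int p \<le> int p * T" "int q \<le> int q * T"
    using \<open>T > 0\<close> by (simp_all add: mult_le_cancel_left1)
  moreover have "- (2 * int p + int q) * T = - (2 * (int p * T)) - int q * T"
    "2 * int p * T = 2 * (int p * T)"
    by (simp_all add: algebra_simps)
  ultimately have "- (2 * int p + int q) * T < H * T" "H * T < 2 * int p * T"
    using HT D E by linarith+
  then have "- (2 * int p + int q) < H" "H < 2 * int p"
    using \<open>T > 0\<close> by (auto dest: mult_right_less_imp_less)
  with E HE show ?thesis
    unfolding cut_box_def by simp
qed

definition antisym_solution :: "nat \<Rightarrow> nat \<Rightarrow> bool list \<Rightarrow> bool list \<Rightarrow> bool" where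
  "antisym_solution p q u v \<longleftrightarrow>
     u \<noteq> [] \<and> hd u \<and> v \<noteq> [] \<and> hd v \<and> length v \<le> length u \<and> defect p q u v = 0"

lemma shorter_antisym_solution:
  assumes "1 \<le> p" "1 \<le> q" "antisym_solution p q u v" "card (cut_box p q) < length v"
  shows "\<exists>u' v'. antisym_solution p q u' v' \<and> length v' < length v"
proof -
  define d where "d = length u - length v"
  define K where "K = card (cut_box p q)"
  define f where "f = cut_state p q d u v"
  have sol: "u \<noteq> []" "hd u" "v \<noteq> []" "hd v" "length v \<le> length u" "defect p q u v = 0"
    using assms(3) unfolding antisym_solution_def by auto
  have "int q * 4 ^ d < 2 * int p"
    unfolding d_def using length_gap_bound sol assms(1) by blast
  then have "f ` {1..K + 1} \<subseteq> cut_box p q"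
    unfolding f_def using cut_state_in_box[OF assms(1,2) sol(5) d_def _ sol(6)] assms(4) K_def
    by auto
  then have "card (f ` {1..K + 1}) \<le> K"
    unfolding K_def cut_box_def by (intro card_mono) auto
  then have "\<not> inj_on f {1..K + 1}"
    by (intro pigeonhole) simp
  then obtain a b where ab: "a \<in> {1..K + 1}" "b \<in> {1..K + 1}" "a \<noteq> b" "f a = f b"
    unfolding inj_on_def by blast
  define k1 k2 where "k1 = min a b" and "k2 = max a b"
  have k: "1 \<le> k1" "k1 < k2" "k2 \<le> length v" "f k1 = f k2"
    using ab assms(4) unfolding k1_def k2_def K_def by (auto simp: min_def max_def)
  define u' v' where "u' = take k1 u @ drop k2 u" and "v' = take k1 v @ drop k2 v"
  have "defect p q u' v' = 0"
    unfolding u'_def v'_def using defect_pump[OF sol(5) d_def] k sol(6) f_def by simp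
  moreover have "length v' \<le> length u'" "length v' < length v"
    unfolding u'_def v'_def using k sol(5) by auto
  moreover have "u' \<noteq> []" "hd u'" "v' \<noteq> []" "hd v'"
    unfolding u'_def v'_def using k sol by auto
  ultimately show ?thesis
    unfolding antisym_solution_def by blast
qed

lemma short_antisym_solution:
  assumes "1 \<le> p" "1 \<le> q" "antisym_solution p q u v"
  shows "\<exists>u' v'. antisym_solution p q u' v' \<and> length v' \<le> card (cut_box p q)"
  using assms(3)
proof (induction "length v" arbitrary: u v rule: less_induct)
  case less
  show ?case
  proof (cases "card (cut_box p q) < length v")
    case True
    then obtain u' v' where "antisym_solution p q u' v'" "length v' < length v"
      using shorter_antisym_solution[OF assms(1,2) less.prems] by blast
    then show ?thesis
      using less.hyps by blast
  next
    case False
    then show ?thesis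
      using less.prems by (metis not_less)
  qed
qed

definition solution_bound :: "nat \<Rightarrow> nat \<Rightarrow> nat" where
  "solution_bound p q = 4 ^ ((4 * p + 4 * q + 1) * (p + q + 1) + 2 * p + 2 * q)"

lemma solution_bound_commute: "solution_bound q p = solution_bound p q"
  unfolding solution_bound_def by (simp add: algebra_simps)

lemma small_antisym_solution:
  assumes "1 \<le> p" "1 \<le> q" "antisym_solution p q u v"
  shows "\<exists>u' v'. antisym_solution p q u' v' \<and>
    nat_of_bits (u' @ anti_rev u') < solution_bound p q \<and>
    nat_of_bits (v' @ anti_rev v') < solution_bound p q"
proof -
  obtain u' v' where sol: "antisym_solution p q u' v'" and short: "length v' \<le> card (cut_box p q)"
    using short_antisym_solution[OF assms] by blast
  define d where "d = length u' - length v'"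
  have "4 ^ d \<le> int q * 4 ^ d"
    using assms(2) by simp
  also have "\<dots> < 2 * int p"
    unfolding d_def using length_gap_bound sol assms(1) unfolding antisym_solution_def by blast
  finally have "int (4 ^ d) < int (2 * p)"
    by simp
  then have "(4::nat) ^ d < 2 * p"
    by (simp only: of_nat_less_iff)
  moreover have "d < (4::nat) ^ d"
    by (rule less_le_trans[OF less_exp]) (simp add: power_mono)
  ultimately have "length u' \<le> card (cut_box p q) + 2 * p"
    using short sol unfolding d_def antisym_solution_def by linarith
  also have "\<dots> \<le> (4 * p + 4 * q + 1) * (p + q + 1) + 2 * p + 2 * q"
    unfolding card_cut_box by (simp add: algebra_simps)
  finally have u'_le: "length u' \<le> (4 * p + 4 * q + 1) * (p + q + 1) + 2 * p + 2 * q" .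
  then have "4 ^ length u' \<le> solution_bound p q"
    unfolding solution_bound_def by (rule power_increasing) simp
  moreover have "4 ^ length v' \<le> solution_bound p q"
    unfolding solution_bound_def
    using sol u'_le unfolding antisym_solution_def by (intro power_increasing) simp_all
  ultimately show ?thesis
    using sol nat_of_bits_antisym_less[of u'] nat_of_bits_antisym_less[of v']
    by (meson order_less_le_trans)
qed

definition antipal_ratio_pair :: "nat \<Rightarrow> nat \<Rightarrow> nat \<Rightarrow> nat \<Rightarrow> bool" where
  "antipal_ratio_pair p q A B \<longleftrightarrow> q * A = p * B \<and> antipalindromic A \<and> antipalindromic B"

lemma small_antipalindromic_solution:
  assumes "1 \<le> p" "1 \<le> q" "antipal_ratio_pair p q A B"
  shows "\<exists>A' B'. antipal_ratio_pair p q A' B' \<and> A' < solution_bound p q \<and> B' < solution_bound p q"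
proof -
  obtain u v where "u \<noteq> []" "hd u" "A = nat_of_bits (u @ anti_rev u)"
      "v \<noteq> []" "hd v" "B = nat_of_bits (v @ anti_rev v)"
    using assms(3) unfolding antipal_ratio_pair_def antipalindromic_iff by blast
  then have uv: "length v \<le> length u \<Longrightarrow> antisym_solution p q u v"
      "length u \<le> length v \<Longrightarrow> antisym_solution q p v u"
    using assms(3) unfolding antisym_solution_def antipal_ratio_pair_def defect_eq_0_iff by auto
  show ?thesis
  proof (cases "length v \<le> length u")
    case True
    with small_antisym_solution[OF assms(1,2) uv(1)] show ?thesis
      unfolding antipal_ratio_pair_def antipalindromic_iff antisym_solution_def defect_eq_0_iff
      by blast
  next
    case False
    with small_antisym_solution[OF assms(2,1) uv(2)] show ?thesis
      unfolding antipal_ratio_pair_def antipalindromic_iff antisym_solution_def defect_eq_0_iff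
        solution_bound_commute[of q p]
      by (metis nat_le_linear)
  qed
qed

lemma rat_ratio_eq_iff:
  assumes "0 < q" "0 < B"
  shows "(of_nat p / of_nat q :: rat) = of_nat A / of_nat B \<longleftrightarrow> q * A = p * B"
proof -
  have "(of_nat p / of_nat q :: rat) = of_nat A / of_nat B \<longleftrightarrow>
      (of_nat p * of_nat B :: rat) = of_nat A * of_nat q"
    using assms by (simp add: frac_eq_eq)
  also have "\<dots> \<longleftrightarrow> p * B = A * q"
    by (simp only: of_nat_mult[symmetric] of_nat_eq_iff)
  also have "\<dots> \<longleftrightarrow> q * A = p * B"
    by (metis mult.commute)
  finally show ?thesis .
qed

lemma antipalindromic_ratio_iff_bounded:
  assumes "1 \<le> p" "1 \<le> q"
  shows "(\<exists>A B. antipalindromic A \<and> antipalindromic B \<and> (of_nat p / of_nat q :: rat) = of_nat A / of_nat B)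
    \<longleftrightarrow> (\<exists>A. 1 \<le> A \<and> A \<le> solution_bound p q \<and>
           (\<exists>B. 1 \<le> B \<and> B \<le> solution_bound p q \<and> antipal_ratio_pair p q A B))"
    (is "?ratio \<longleftrightarrow> ?bounded")
proof
  assume ?ratio
  then obtain A B where AB: "antipalindromic A" "antipalindromic B"
      "(of_nat p / of_nat q :: rat) = of_nat A / of_nat B"
    by blast
  then have "antipal_ratio_pair p q A B"
    unfolding antipal_ratio_pair_def
    using rat_ratio_eq_iff[of q B p A] assms(2) antipalindromic_pos[OF AB(2)] by simp
  then obtain A' B' where AB': "antipal_ratio_pair p q A' B'"
      "A' < solution_bound p q" "B' < solution_bound p q"
    using small_antipalindromic_solution[OF assms] by blast
  moreover have "1 \<le> A'" "1 \<le> B'"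
    using AB'(1) antipalindromic_pos unfolding antipal_ratio_pair_def by (simp_all add: Suc_le_eq)
  ultimately show ?bounded
    by (meson less_imp_le)
next
  assume ?bounded
  then obtain A B where AB: "antipalindromic A" "antipalindromic B" "q * A = p * B"
    unfolding antipal_ratio_pair_def by blast
  then have "(of_nat p / of_nat q :: rat) = of_nat A / of_nat B"
    using rat_ratio_eq_iff[of q B p A] assms(2) antipalindromic_pos[OF AB(2)] by simp
  with AB show ?ratio
    by blast
qed

section \<open>The decision procedure as a WHILE program\<close>

text \<open>Registers: p and q arrive in 0 and 1, and the answer is left in 0. The main loops
  use 10 to 15 (p, q, the search bound, A, B and the first test result); pow_prog computes
  r22 := r20 ^ r21 using 23; half_prog computes r32 := r30 div 2; peel_test_prog tests
  r40 with k = r41, using 43, and leaves its verdict in 42; antipal_prog tests r50 with the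
  counter 52 and leaves its verdict in 51.\<close>

definition wpt :: "com \<Rightarrow> state \<Rightarrow> (state \<Rightarrow> bool) \<Rightarrow> bool" where
  "wpt c s Q \<longleftrightarrow> (\<exists>t. big_step c s t \<and> Q t)"

lemma wpt_Seq: "wpt c1 s (\<lambda>m. wpt c2 m Q) \<Longrightarrow> wpt (Seq c1 c2) s Q"
  unfolding wpt_def by (blast intro: big_step.Seq)

lemma wpt_Assign: "Q (s(x := aval a s)) \<Longrightarrow> wpt (Assign x a) s Q"
  unfolding wpt_def by (blast intro: big_step.Assign)

lemma wpt_SKIP: "Q s \<Longrightarrow> wpt SKIP s Q"
  unfolding wpt_def by (blast intro: big_step.Skip)

lemma wpt_If:
  "(bval b s \<Longrightarrow> wpt c1 s Q) \<Longrightarrow> (\<not> bval b s \<Longrightarrow> wpt c2 s Q) \<Longrightarrow> wpt (If b c1 c2) s Q"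
  unfolding wpt_def by (cases "bval b s") (blast intro: big_step.IfTrue big_step.IfFalse)+

lemma wpt_mono: "wpt c s P \<Longrightarrow> (\<And>t. P t \<Longrightarrow> Q t) \<Longrightarrow> wpt c s Q"
  unfolding wpt_def by blast

lemma wpt_While:
  fixes f :: "state \<Rightarrow> nat"
  assumes "I s"
    and step: "\<And>s. I s \<Longrightarrow> bval b s \<Longrightarrow> wpt c s (\<lambda>t. I t \<and> f t < f s)"
    and fin: "\<And>s. I s \<Longrightarrow> \<not> bval b s \<Longrightarrow> Q s"
  shows "wpt (While b c) s Q"
  using assms(1)
proof (induction "f s" arbitrary: s rule: less_induct)
  case less
  show ?case
  proof (cases "bval b s")
    case True
    from step[OF less.prems True] obtain m where m: "big_step c s m" "I m" "f m < f s"
      unfolding wpt_def by blast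
    from less.hyps[OF m(3) m(2)] obtain t where "big_step (While b c) m t" "Q t"
      unfolding wpt_def by blast
    then show ?thesis unfolding wpt_def using True m(1) by (blast intro: big_step.WhileTrue)
  next
    case False
    then show ?thesis unfolding wpt_def using fin[OF less.prems False] by (blast intro: big_step.WhileFalse)
  qed
qed

definition pow_prog :: com where
  "pow_prog = Seq (Assign 22 (N 1)) (Seq (Assign 23 (N 0))
     (While (Less (V 23) (V 21)) (Seq (Assign 22 (Times (V 22) (V 20))) (Assign 23 (Plus (V 23) (N 1))))))"

lemma wpt_pow_prog: "wpt pow_prog s (\<lambda>t. t 22 = s 20 ^ s 21 \<and> (\<forall>i. i \<noteq> 22 \<and> i \<noteq> 23 \<longrightarrow> t i = s i))"
  unfolding pow_prog_def
  apply (rule wpt_Seq, rule wpt_Assign, rule wpt_Seq, rule wpt_Assign)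
  apply (rule wpt_While[where I = "\<lambda>t. t 22 = s 20 ^ t 23 \<and> t 23 \<le> s 21 \<and> (\<forall>i. i \<noteq> 22 \<and> i \<noteq> 23 \<longrightarrow> t i = s i)"
        and f = "\<lambda>t. s 21 - t 23"])
    apply simp
   apply (rule wpt_Seq, rule wpt_Assign, rule wpt_Assign)
   apply (auto simp: power_Suc2)
  done

definition half_prog :: com where
  "half_prog = Seq (Assign 32 (N 0))
     (While (Less (Times (Plus (V 32) (N 1)) (N 2)) (Plus (V 30) (N 1))) (Assign 32 (Plus (V 32) (N 1))))"

lemma wpt_half_prog: "wpt half_prog s (\<lambda>t. t 32 = s 30 div 2 \<and> (\<forall>i. i \<noteq> 32 \<longrightarrow> t i = s i))"
  unfolding half_prog_def
  apply (rule wpt_Seq, rule wpt_Assign)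
  apply (rule wpt_While[where I = "\<lambda>t. 2 * t 32 \<le> s 30 \<and> (\<forall>i. i \<noteq> 32 \<longrightarrow> t i = s i)"
        and f = "\<lambda>t. s 30 - t 32"])
    apply simp
   apply (rule wpt_Assign)
   apply auto
  done

text \<open>r43 is the parity the last digit must have (1 iff the leading digit, of weight
  r22 = 2^(2k+1), is 0); the flag r42 is cleared when r40 - 2 r32 differs from it.\<close>
definition peel_step_prog :: com where
  "peel_step_prog = Seq (Assign 20 (N 2)) (Seq (Assign 21 (Minus (Times (N 2) (V 41)) (N 1))) (Seq pow_prog
     (Seq (If (Less (V 40) (V 22)) (Assign 43 (N 1)) (Seq (Assign 40 (Minus (V 40) (V 22))) (Assign 43 (N 0))))
     (Seq (Assign 30 (V 40)) (Seq half_prog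
     (Seq (If (Not (And (Not (Less (Minus (V 40) (Times (N 2) (V 32))) (V 43))) (Not (Less (V 43) (Minus (V 40) (Times (N 2) (V 32)))))))
              (Assign 42 (N 0)) SKIP)
     (Seq (Assign 40 (V 32)) (Assign 41 (Minus (V 41) (N 1))))))))))"

definition peel_regs :: "nat set" where "peel_regs = {20, 21, 22, 23, 30, 32, 40, 41, 42, 43}"

lemma wpt_peel_step_prog:
  assumes "s 41 = Suc k"
  shows "wpt peel_step_prog s (\<lambda>t. t 41 = k \<and>
     t 40 = (if 2 ^ (2 * k + 1) \<le> s 40 then (s 40 - 2 ^ (2 * k + 1)) div 2 else s 40 div 2) \<and>
     t 42 = (if (if 2 ^ (2 * k + 1) \<le> s 40 then even (s 40 - 2 ^ (2 * k + 1)) else odd (s 40)) then s 42 else 0) \<and>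
     (\<forall>i. i \<notin> peel_regs \<longrightarrow> t i = s i))"
  unfolding peel_step_prog_def
  apply (intro wpt_Seq wpt_Assign wpt_If wpt_SKIP wpt_mono[OF wpt_pow_prog] wpt_mono[OF wpt_half_prog])
  using assms by (auto simp: peel_regs_def elim: oddE)

definition peel_test_prog :: com where
  "peel_test_prog = Seq (Assign 42 (N 1)) (Seq (While (Less (N 0) (V 41)) peel_step_prog) (If (Less (N 0) (V 40)) (Assign 42 (N 0)) SKIP))"

lemma peel_test_step:
  assumes "t42 = (0::nat) \<or> t42 = 1"
    "A' = (if 2 ^ (2 * k + 1) \<le> A then (A - 2 ^ (2 * k + 1)) div 2 else A div 2)"
    "t42' = (if (if 2 ^ (2 * k + 1) \<le> A then even (A - 2 ^ (2 * k + 1)) else odd A) then t42 else 0)"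
  shows "(t42' = 1 \<and> peel_test k A') \<longleftrightarrow> (t42 = 1 \<and> peel_test (Suc k) A)"
  using assms by (cases "2 ^ (2 * k + 1) \<le> A") auto

lemma wpt_peel_test_prog:
  "wpt peel_test_prog s (\<lambda>t. (t 42 = 0 \<or> t 42 = 1) \<and> (t 42 = 1 \<longleftrightarrow> peel_test (s 41) (s 40)) \<and>
     (\<forall>i. i \<notin> peel_regs \<longrightarrow> t i = s i))"
  unfolding peel_test_prog_def
  apply (rule wpt_Seq, rule wpt_Assign, rule wpt_Seq)
  apply (rule wpt_While[where I = "\<lambda>t. (t 42 = 0 \<or> t 42 = 1) \<and>
      ((t 42 = 1 \<and> peel_test (t 41) (t 40)) \<longleftrightarrow> peel_test (s 41) (s 40)) \<and>
      (\<forall>i. i \<notin> peel_regs \<longrightarrow> t i = s i)"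
        and f = "\<lambda>t. t 41"])
    apply (simp add: peel_regs_def)
  subgoal premises prems for t
  proof -
    obtain k where k: "t 41 = Suc k"
      using prems(2) by (cases "t 41") auto
    show ?thesis
      by (rule wpt_mono[OF wpt_peel_step_prog[of t k, OF k]]) (use prems k peel_test_step[of "t 42"] in auto)
  qed
  apply (rule wpt_If)
   apply (rule wpt_Assign)
   apply (auto simp: peel_regs_def)[1]
  apply (rule wpt_SKIP)
  apply (auto simp: peel_regs_def)
  done

definition antipal_step_prog :: com where
  "antipal_step_prog = Seq (Assign 20 (N 2)) (Seq (Assign 21 (Minus (Times (N 2) (V 52)) (N 1))) (Seq pow_prog
     (Seq (If (Less (V 50) (V 22)) SKIP
        (Seq (Assign 40 (V 50)) (Seq (Assign 41 (V 52)) (Seq peel_test_prog (If (Less (N 0) (V 42)) (Assign 51 (N 1)) SKIP)))))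
     (Assign 52 (Plus (V 52) (N 1))))))"

definition antipal_prog :: com where
  "antipal_prog = Seq (Assign 51 (N 0)) (Seq (Assign 52 (N 1)) (While (Less (V 52) (Plus (V 50) (N 1))) antipal_step_prog))"

definition antipal_regs :: "nat set" where "antipal_regs = {20, 21, 22, 23, 30, 32, 40, 41, 42, 43, 51, 52}"

lemma wpt_antipal_step_prog:
  "wpt antipal_step_prog s (\<lambda>t. t 52 = s 52 + 1 \<and> t 50 = s 50 \<and>
     (0 < t 51 \<longleftrightarrow> 0 < s 51 \<or> 2 ^ (2 * s 52 - 1) \<le> s 50 \<and> peel_test (s 52) (s 50)) \<and>
     (\<forall>i. i \<notin> antipal_regs \<longrightarrow> t i = s i))"
  unfolding antipal_step_prog_def
  by (intro wpt_Seq wpt_Assign wpt_If wpt_SKIP wpt_mono[OF wpt_pow_prog] wpt_mono[OF wpt_peel_test_prog])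
    (auto simp: antipal_regs_def peel_regs_def)

lemma wpt_antipal_prog:
  "wpt antipal_prog s (\<lambda>t. (0 < t 51 \<longleftrightarrow> antipalindromic (s 50)) \<and> (\<forall>i. i \<notin> antipal_regs \<longrightarrow> t i = s i))"
  unfolding antipal_prog_def
  apply (intro wpt_Seq wpt_Assign)
  apply (rule wpt_While[where I = "\<lambda>t. t 50 = s 50 \<and> 1 \<le> t 52 \<and> t 52 \<le> s 50 + 1 \<and>
      (0 < t 51 \<longleftrightarrow> (\<exists>m. 1 \<le> m \<and> m < t 52 \<and> 2 ^ (2 * m - 1) \<le> s 50 \<and> peel_test m (s 50))) \<and>
      (\<forall>i. i \<notin> antipal_regs \<longrightarrow> t i = s i)"
        and f = "\<lambda>t. s 50 + 1 - t 52"])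
    apply (simp add: antipal_regs_def)
  subgoal
    by (rule wpt_mono[OF wpt_antipal_step_prog]) (auto simp: less_Suc_eq)
  subgoal
    using antipalindromic_iff_peel_test[of "s 50"] by (auto simp: Suc_le_eq less_Suc_eq_le)
  done

definition inner_step_prog :: com where
  "inner_step_prog = Seq (If (And (Not (Less (Times (V 11) (V 13)) (Times (V 10) (V 14)))) (Not (Less (Times (V 10) (V 14)) (Times (V 11) (V 13)))))
     (Seq (Assign 50 (V 13)) (Seq antipal_prog (Seq (Assign 15 (V 51)) (Seq (Assign 50 (V 14)) (Seq antipal_prog
        (If (And (Less (N 0) (V 15)) (Less (N 0) (V 51))) (Assign 0 (N 1)) SKIP)))))) SKIP)
     (Assign 14 (Plus (V 14) (N 1)))"

definition outer_step_prog :: com where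
  "outer_step_prog = Seq (Assign 14 (N 1)) (Seq (While (Less (V 14) (Plus (V 12) (N 1))) inner_step_prog) (Assign 13 (Plus (V 13) (N 1))))"

definition bound_exponent :: aexp where
  "bound_exponent = Plus (Plus (Times (Plus (Plus (Times (N 4) (V 10)) (Times (N 4) (V 11))) (N 1)) (Plus (Plus (V 10) (V 11)) (N 1))) (Times (N 2) (V 10))) (Times (N 2) (V 11))"

definition decide_prog :: com where
  "decide_prog = Seq (Assign 10 (V 0)) (Seq (Assign 11 (V 1)) (Seq (Assign 20 (N 4)) (Seq (Assign 21 bound_exponent) (Seq pow_prog
     (Seq (Assign 12 (V 22)) (Seq (Assign 0 (N 0)) (Seq (Assign 13 (N 1)) (While (Less (V 13) (Plus (V 12) (N 1))) outer_step_prog))))))))"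

lemma wpt_inner_step_prog:
  assumes "s 0 = 0 \<or> s 0 = 1"
  shows "wpt inner_step_prog s (\<lambda>t. t 14 = s 14 + 1 \<and> t 10 = s 10 \<and> t 11 = s 11 \<and> t 12 = s 12 \<and> t 13 = s 13 \<and>
     (t 0 = 0 \<or> t 0 = 1) \<and>
     (t 0 = 1 \<longleftrightarrow> s 0 = 1 \<or> antipal_ratio_pair (s 10) (s 11) (s 13) (s 14)))"
  unfolding inner_step_prog_def
  using assms by (intro wpt_Seq wpt_Assign wpt_If wpt_SKIP wpt_mono[OF wpt_antipal_prog])
    (auto simp: antipal_regs_def antipal_ratio_pair_def)

lemma wpt_outer_step_prog:
  assumes "s 0 = 0 \<or> s 0 = 1"
  shows "wpt outer_step_prog s (\<lambda>t. t 13 = s 13 + 1 \<and> t 10 = s 10 \<and> t 11 = s 11 \<and> t 12 = s 12 \<and>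
     (t 0 = 0 \<or> t 0 = 1) \<and>
     (t 0 = 1 \<longleftrightarrow> s 0 = 1 \<or>
        (\<exists>B. 1 \<le> B \<and> B \<le> s 12 \<and> antipal_ratio_pair (s 10) (s 11) (s 13) B)))"
  unfolding outer_step_prog_def
  apply (intro wpt_Seq wpt_Assign)
  apply (rule wpt_While[where I = "\<lambda>t. t 10 = s 10 \<and> t 11 = s 11 \<and> t 12 = s 12 \<and> t 13 = s 13 \<and>
      1 \<le> t 14 \<and> t 14 \<le> s 12 + 1 \<and> (t 0 = 0 \<or> t 0 = 1) \<and>
      (t 0 = 1 \<longleftrightarrow> s 0 = 1 \<or>
         (\<exists>B. 1 \<le> B \<and> B < t 14 \<and> antipal_ratio_pair (s 10) (s 11) (s 13) B))"
        and f = "\<lambda>t. s 12 + 1 - t 14"])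
    using assms apply simp
  subgoal
    by (rule wpt_mono[OF wpt_inner_step_prog]) (auto simp: less_Suc_eq)
  subgoal
    by (rule wpt_Assign) (auto simp: less_Suc_eq_le)
  done

lemma wpt_decide_prog:
  "wpt decide_prog s (\<lambda>t. t 0 = 1 \<longleftrightarrow>
     (\<exists>A. 1 \<le> A \<and> A \<le> solution_bound (s 0) (s 1) \<and>
        (\<exists>B. 1 \<le> B \<and> B \<le> solution_bound (s 0) (s 1) \<and> antipal_ratio_pair (s 0) (s 1) A B)))"
  unfolding decide_prog_def
  apply (intro wpt_Seq wpt_Assign wpt_mono[OF wpt_pow_prog])
  subgoal for t
    apply (rule wpt_While[where I = "\<lambda>u. u 10 = s 0 \<and> u 11 = s 1 \<and> u 12 = solution_bound (s 0) (s 1) \<and>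
        1 \<le> u 13 \<and> u 13 \<le> solution_bound (s 0) (s 1) + 1 \<and> (u 0 = 0 \<or> u 0 = 1) \<and>
        (u 0 = 1 \<longleftrightarrow> (\<exists>A. 1 \<le> A \<and> A < u 13 \<and>
           (\<exists>B. 1 \<le> B \<and> B \<le> solution_bound (s 0) (s 1) \<and> antipal_ratio_pair (s 0) (s 1) A B)))"
        and f = "\<lambda>u. solution_bound (s 0) (s 1) + 1 - u 13"])
      apply (simp add: solution_bound_def bound_exponent_def)
    subgoal
      by (rule wpt_mono[OF wpt_outer_step_prog]) (auto simp: less_Suc_eq)
    subgoal
      by (auto simp: less_Suc_eq_le)
    done
  done

theorem theorem23:
  shows "\<exists>c::com. \<forall>p q::nat. p \<ge> 1 \<longrightarrow> q \<ge> 1 \<longrightarrow>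
           (\<exists>t. big_step c (init2 p q) t \<and>
               (t 0 = 1 \<longleftrightarrow>
                 (\<exists>A B. antipalindromic A \<and> antipalindromic B \<and>
                    (of_nat p / of_nat q :: rat) = of_nat A / of_nat B)))"
proof (intro exI[of _ decide_prog] allI impI)
  fix p q :: nat
  assume "p \<ge> 1" "q \<ge> 1"
  have "init2 p q 0 = p" "init2 p q 1 = q"
    by (simp_all add: init2_def)
  with wpt_decide_prog[of "init2 p q"] obtain t where "big_step decide_prog (init2 p q) t"
    and "t 0 = 1 \<longleftrightarrow> (\<exists>A. 1 \<le> A \<and> A \<le> solution_bound p q \<and>
        (\<exists>B. 1 \<le> B \<and> B \<le> solution_bound p q \<and> antipal_ratio_pair p q A B))"
    unfolding wpt_def by auto
  with antipalindromic_ratio_iff_bounded[OF \<open>p \<ge> 1\<close> \<open>q \<ge> 1\<close>] show "\<exists>t. big_step decide_prog (init2 p q) t \<and>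
      (t 0 = 1 \<longleftrightarrow> (\<exists>A B. antipalindromic A \<and> antipalindromic B \<and>
         (of_nat p / of_nat q :: rat) = of_nat A / of_nat B))"
    by blast
qed

end
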